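(* Let $n\ge 2$ and let $C_n$ be the simple directed cycle with vertices $v_0,v_1,\dots,v_{n-1}$ and with edges directed from $v_{i+1}$ to $v_i$ for all $0\le i\le n-1$ (indices modulo $n$). The possible periods of parallel chip-firing games on $C_n$ are exactly the positive divisors of $n$; that is, for a positive integer $T$, there exists a parallel chip-firing game on $C_n$ with period $T$ if and only if $T\mid n$.
   Context: A directed graph $D=(V,E)$ is a finite set of vertices $V$ with a set $E$ of ordered pairs of vertices; $(u,v)\in E$ is an edge directed from $u$ to $v$, and the out-degree $\deg^+ v$ is the number of edges directed from $v$. A parallel chip-firing game on $D$ starts with a finite nonnegative integer number of chips on each vertex. In each round, simultaneously, every vertex $v$ having at least $\deg^+ v$ chips fires, sending one chip along each of its outgoing edges; all other vertices wait. The game has period $T$ if $T$ is the smallest positive integer for which there is a round $t_0$ such that every vertex has the same number of chips in round $t$ as in round $t+T$ for all $t\ge t_0$. *)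

theory Defs
  imports "Graph_Theory.Digraph" "Graph_Theory.Pair_Digraph"
begin

text \<open>
  A distribution of chips is a function \<open>c :: 'a \<Rightarrow> nat\<close>; only its values on
  \<open>pverts D\<close> are meaningful, and only these are compared in the definition of the period.
\<close>

definition fires :: "'a pair_pre_digraph \<Rightarrow> ('a \<Rightarrow> nat) \<Rightarrow> 'a \<Rightarrow> bool" where
  "fires D c v \<longleftrightarrow> out_degree (with_proj D) v \<le> c v"

definition pcf_step :: "'a pair_pre_digraph \<Rightarrow> ('a \<Rightarrow> nat) \<Rightarrow> ('a \<Rightarrow> nat)" where
  "pcf_step D c = (\<lambda>v.
     (if fires D c v then c v - out_degree (with_proj D) v else c v)
     + card {e \<in> in_arcs (with_proj D) v. fires D c (fst e)})"

definition pcf_game :: "'a pair_pre_digraph \<Rightarrow> ('a \<Rightarrow> nat) \<Rightarrow> nat \<Rightarrow> ('a \<Rightarrow> nat)" where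
  "pcf_game D c t = (pcf_step D ^^ t) c"

definition eventually_repeats :: "'a pair_pre_digraph \<Rightarrow> ('a \<Rightarrow> nat) \<Rightarrow> nat \<Rightarrow> bool" where
  "eventually_repeats D c T \<longleftrightarrow>
     (\<exists>t0. \<forall>t\<ge>t0. \<forall>v\<in>pverts D. pcf_game D c t v = pcf_game D c (t + T) v)"

definition has_period :: "'a pair_pre_digraph \<Rightarrow> ('a \<Rightarrow> nat) \<Rightarrow> nat \<Rightarrow> bool" where
  "has_period D c T \<longleftrightarrow>
     T > 0 \<and> eventually_repeats D c T \<and> (\<forall>S>0. eventually_repeats D c S \<longrightarrow> T \<le> S)"

text \<open>The number \<open>i\<close> stands for the vertex \<open>v\<^sub>i\<close>.\<close>

definition directed_cycle :: "nat \<Rightarrow> nat pair_pre_digraph" where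
  "directed_cycle n = \<lparr> pverts = {..<n}, parcs = {(Suc i mod n, i) | i. i < n} \<rparr>"

lemma pair_digraph_directed_cycle:
  assumes "n \<ge> 2"
  shows "pair_digraph (directed_cycle n)"
proof
  show "finite (parcs (directed_cycle n))"
    by (simp add: directed_cycle_def)
  show "fst e \<noteq> snd e" if "e \<in> parcs (directed_cycle n)" for e
    using that assms by (auto simp: directed_cycle_def mod_Suc split: if_splits)
qed (use assms in \<open>auto simp: directed_cycle_def\<close>)

end

theory Submission
  imports Defs
begin

text \<open>
  If a vertex is empty after a round, its predecessor was empty before the round. So the set of
  empty vertices, shifted by one, can only shrink; once its size is constant, it merely rotates,
  and then the number of chips on a vertex minus the indicator of its firing no longer changes.
  Hence the game eventually repeats after \<open>n\<close> rounds, and its period divides \<open>n\<close>. Conversely, if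
  \<open>T\<close> divides \<open>n\<close>, one chip on each \<open>v\<^sub>i\<close> with \<open>T\<close> dividing \<open>i\<close> gives a rotating pattern
  of period \<open>T\<close>.
\<close>

lemma eventually_repeats_mult:
  assumes "eventually_repeats D c T"
  shows "eventually_repeats D c (k * T)"
proof -
  from assms obtain t0 where
    t0: "\<And>t v. t \<ge> t0 \<Longrightarrow> v \<in> pverts D \<Longrightarrow> pcf_game D c (t + T) v = pcf_game D c t v"
    unfolding eventually_repeats_def by metis
  have "pcf_game D c (t + k * T) v = pcf_game D c t v" if "t \<ge> t0" "v \<in> pverts D" for t v
  proof (induction k)
    case (Suc k)
    have "pcf_game D c (t + k * T + T) v = pcf_game D c (t + k * T) v"
      using t0 that by simp
    with Suc show ?case by (simp add: algebra_simps)
  qed simp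
  then show ?thesis
    unfolding eventually_repeats_def by metis
qed

text \<open>In late rounds the distributions at \<open>t\<close> and at \<open>t + r\<close> both
  agree with the one at \<open>t + r + T\<close>. This is the subtraction step for reducing a
  repetition length modulo another.\<close>

lemma eventually_repeats_diff:
  assumes "eventually_repeats D c (r + T)" "eventually_repeats D c T"
  shows "eventually_repeats D c r"
proof -
  from assms obtain t1 t2 where
    t1: "\<And>t v. t \<ge> t1 \<Longrightarrow> v \<in> pverts D \<Longrightarrow> pcf_game D c (t + (r + T)) v = pcf_game D c t v" and
    t2: "\<And>t v. t \<ge> t2 \<Longrightarrow> v \<in> pverts D \<Longrightarrow> pcf_game D c (t + T) v = pcf_game D c t v"
    unfolding eventually_repeats_def by metis
  have "pcf_game D c t v = pcf_game D c (t + r) v" if "t \<ge> max t1 t2" "v \<in> pverts D" for t v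
    using t1[of t v] t2[of "t + r" v] that by (simp add: add.assoc)
  then show ?thesis
    unfolding eventually_repeats_def by blast
qed

text \<open>The remainder \<open>n mod T\<close> is itself a repetition length and is smaller than
  \<open>T\<close>, so minimality of \<open>T\<close> forces it to be 0.\<close>

lemma has_period_dvd:
  assumes "has_period D c T" "eventually_repeats D c n"
  shows "T dvd n"
proof -
  have "eventually_repeats D c (n mod T + n div T * T)"
    using assms(2) by simp
  moreover have "eventually_repeats D c (n div T * T)"
    using assms(1) eventually_repeats_mult unfolding has_period_def by blast
  ultimately have "eventually_repeats D c (n mod T)"
    by (rule eventually_repeats_diff)
  then have "n mod T = 0"
    using assms(1) mod_less_divisor[of T n] unfolding has_period_def by fastforce
  then show ?thesis by auto
qed

lemma inj_on_Suc_mod: "inj_on (\<lambda>i. Suc i mod n) {..<n}"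
  by (auto simp: inj_on_def mod_Suc split: if_splits)

lemma Suc_mod_surj:
  assumes "v < n"
  obtains i where "i < n" "v = Suc i mod n"
proof (cases v)
  case 0
  then show ?thesis using that[of "n - 1"] assms by simp
next
  case (Suc i)
  then show ?thesis using that[of i] assms by simp
qed

lemma out_degree_directed_cycle:
  assumes "v < n"
  shows "out_degree (with_proj (directed_cycle n)) v = 1"
proof -
  obtain i where i: "i < n" "v = Suc i mod n"
    using Suc_mod_surj[OF assms] .
  have "j = i" if "j < n" "Suc j mod n = v" for j
    using inj_onD[OF inj_on_Suc_mod, of j n i] i that by (metis lessThan_iff)
  with i have "{(Suc j mod n, j) | j. j < n \<and> Suc j mod n = v} = {(v, i)}"
    by blast
  moreover have "out_arcs (with_proj (directed_cycle n)) v =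
      {(Suc j mod n, j) | j. j < n \<and> Suc j mod n = v}"
    by (auto simp: out_arcs_def directed_cycle_def)
  ultimately have "out_arcs (with_proj (directed_cycle n)) v = {(v, i)}"
    by (rule trans[rotated])
  then show ?thesis by (simp add: out_degree_def)
qed

lemma in_arcs_directed_cycle:
  assumes "v < n"
  shows "in_arcs (with_proj (directed_cycle n)) v = {(Suc v mod n, v)}"
  using assms by (auto simp: in_arcs_def directed_cycle_def)

text \<open>Every out-degree is 1, so firing means being nonempty. Truncated subtraction then covers
  both cases at once: an empty vertex waits and stays at 0.\<close>

lemma pcf_step_directed_cycle:
  assumes "v < n"
  shows "pcf_step (directed_cycle n) c v = c v - 1 + of_bool (c (Suc v mod n) > 0)"
proof -
  have "Suc v mod n < n" using assms by simp
  then have "{e \<in> in_arcs (with_proj (directed_cycle n)) v. fires (directed_cycle n) c (fst e)}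
    = (if c (Suc v mod n) > 0 then {(Suc v mod n, v)} else {})"
    using assms by (auto simp: in_arcs_directed_cycle fires_def out_degree_directed_cycle)
  then show ?thesis
    using assms by (simp add: pcf_step_def fires_def out_degree_directed_cycle)
qed

lemma pcf_game_directed_cycle_Suc:
  assumes "v < n"
  shows "pcf_game (directed_cycle n) c (Suc t) v =
    pcf_game (directed_cycle n) c t v - 1 + of_bool (pcf_game (directed_cycle n) c t (Suc v mod n) > 0)"
  unfolding pcf_game_def funpow.simps comp_apply by (rule pcf_step_directed_cycle[OF assms])

text \<open>The value type of \<open>f\<close> is left open so that this serves both the truth
  values of firing and the chip counts.\<close>

lemma rotation_iterate:
  assumes "\<And>t i. t \<ge> t0 \<Longrightarrow> i < n \<Longrightarrow> f (Suc t) i = f t (Suc i mod n)"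
    and "t \<ge> t0" "i < n"
  shows "f (t + k) i = f t ((i + k) mod n)"
  using assms(2)
proof (induction k arbitrary: t)
  case 0
  then show ?case using assms(3) by simp
next
  case (Suc k)
  have "f (t + Suc k) i = f (Suc t) ((i + k) mod n)"
    using Suc.IH[of "Suc t"] Suc.prems by simp
  also have "\<dots> = f t (Suc ((i + k) mod n) mod n)"
    using Suc.prems assms(3) by (intro assms(1)) auto
  finally show ?case by (simp add: mod_Suc_eq)
qed

lemma directed_cycle_firing_eventually_rotates:
  obtains t0 where "\<And>t i. t \<ge> t0 \<Longrightarrow> i < n \<Longrightarrow>
    pcf_game (directed_cycle n) c (Suc t) i > 0 \<longleftrightarrow>
    pcf_game (directed_cycle n) c t (Suc i mod n) > 0"
proof -
  define g where "g = pcf_game (directed_cycle n) c"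
  define Z where "Z t = {i. i < n \<and> g t i = 0}" for t
  define s where "s i = Suc i mod n" for i
  have fin: "finite (Z t)" for t
    by (simp add: Z_def)
  \<comment> \<open>The vertex \<open>s i\<close> is the one that fires into \<open>i\<close>; if it
    held a chip, \<open>i\<close> would be nonempty after the round.\<close>
  have sub: "s ` Z (Suc t) \<subseteq> Z t" for t
    by (auto simp: Z_def g_def s_def pcf_game_directed_cycle_Suc)
  have inj: "inj_on s {..<n}"
    using inj_on_Suc_mod[of n] unfolding s_def .
  have card: "card (s ` Z t) = card (Z t)" for t
    by (rule card_image, rule inj_on_subset[OF inj]) (auto simp: Z_def)
  have "antimono (\<lambda>t. card (Z t))"
    using card_mono[OF fin sub] card by (simp add: antimono_iff_le_Suc)
  \<comment> \<open>A round with the fewest empty vertices; since their number never increases, it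
    is constant from \<open>t0\<close> on.\<close>
  obtain t0 where t0: "\<And>t. card (Z t0) \<le> card (Z t)"
    using ex_has_least_nat[of "\<lambda>_. True" _ "\<lambda>t. card (Z t)"] by blast
  show ?thesis
  proof (rule that)
    fix t i assume "t \<ge> t0" "i < n"
    then have "card (Z t) \<le> card (s ` Z (Suc t))"
      using t0[of "Suc t"] antimonoD[OF \<open>antimono _\<close>] card by (metis order.trans)
    then have "s ` Z (Suc t) = Z t"
      using card_subset_eq[OF fin sub] card_mono[OF fin sub] by (simp add: le_antisym)
    moreover have "i \<in> Z (Suc t) \<longleftrightarrow> s i \<in> s ` Z (Suc t)"
      using inj_on_image_mem_iff[OF inj, of i "Z (Suc t)"] \<open>i < n\<close> by (auto simp: Z_def)
    moreover have "s i < n" using \<open>i < n\<close> by (simp add: s_def)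
    ultimately show "pcf_game (directed_cycle n) c (Suc t) i > 0 \<longleftrightarrow>
        pcf_game (directed_cycle n) c t (Suc i mod n) > 0"
      using \<open>i < n\<close> by (auto simp: Z_def g_def s_def)
  qed
qed

lemma directed_cycle_eventually_repeats: "eventually_repeats (directed_cycle n) c n"
proof -
  define g where "g = pcf_game (directed_cycle n) c"
  obtain t0 where rot: "\<And>t i. t \<ge> t0 \<Longrightarrow> i < n \<Longrightarrow> g (Suc t) i > 0 \<longleftrightarrow> g t (Suc i mod n) > 0"
    using directed_cycle_firing_eventually_rotates[of n c] unfolding g_def by blast
  have "g t i = g (t + n) i" if "t \<ge> t0" "i < n" for t i
  proof -
    have "g (t + n) i > 0 \<longleftrightarrow> g t ((i + n) mod n) > 0"
      using rotation_iterate[of t0 n "\<lambda>t i. g t i > 0"] rot that by blast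
    then have fires: "g (t + n) i > 0 \<longleftrightarrow> g t i > 0"
      using that by simp
    \<comment> \<open>By rotation, \<open>i\<close> receives a chip in this round exactly when it is
      nonempty afterwards, and the truncated subtraction on the left removes exactly that
      chip.\<close>
    have "g (Suc u) i - 1 = g u i - 1" if "u \<ge> t0" for u
      using rot[OF that \<open>i < n\<close>] pcf_game_directed_cycle_Suc[OF \<open>i < n\<close>, of c u]
      by (auto simp: g_def of_bool_def split: if_splits)
    then have "g (t + k) i - 1 = g t i - 1" for k
      using \<open>t \<ge> t0\<close> by (induction k) auto
    \<comment> \<open>Truncated predecessors confuse only the counts 0 and 1, which
      \<open>fires\<close> tells apart.\<close>
    from this[of n] fires show ?thesis by linarith
  qed
  then show ?thesis
    unfolding eventually_repeats_def by (auto simp: g_def directed_cycle_def)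
qed

text \<open>With at most one chip per vertex, every chip moves in every round and no two meet, so
  the whole distribution rotates.\<close>

lemma directed_cycle_sparse_rotates:
  assumes "\<And>i. c i \<le> 1" "i < n"
  shows "pcf_game (directed_cycle n) c t i = c ((i + t) mod n)"
proof -
  define g where "g = pcf_game (directed_cycle n) c"
  have "\<forall>i<n. g t i \<le> 1" for t
  proof (induction t)
    case 0
    then show ?case using assms(1) by (simp add: g_def pcf_game_def)
  next
    case (Suc t)
    then show ?case by (auto simp: g_def pcf_game_directed_cycle_Suc of_bool_def)
  qed
  then have le: "g t i \<le> 1" if "i < n" for t i
    using that by blast
  have "g (Suc t) i = g t (Suc i mod n)" if "i < n" for t i
  proof -
    have "g t (Suc i mod n) \<le> 1"
      using le that by simp
    then show ?thesis
      using le[OF that, of t] pcf_game_directed_cycle_Suc[OF that, of c t]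
      by (cases "g t (Suc i mod n)") (simp_all add: g_def)
  qed
  from rotation_iterate[of 0 n g 0 i t] this assms(2)
  show ?thesis by (simp add: g_def pcf_game_def)
qed

lemma has_period_directed_cycle_multiples:
  assumes "n > 0" "T dvd n"
  shows "has_period (directed_cycle n) (\<lambda>i. of_bool (T dvd i)) T"
proof -
  let ?c = "\<lambda>i. of_bool (T dvd i) :: nat"
  have "T > 0" using assms dvd_pos_nat by blast
  \<comment> \<open>Since \<open>T\<close> divides \<open>n\<close>, reducing an index modulo
    \<open>n\<close> does not affect its divisibility by \<open>T\<close>.\<close>
  have g: "pcf_game (directed_cycle n) ?c t i = of_bool (T dvd i + t)" if "i < n" for t i
    using directed_cycle_sparse_rotates[of ?c i n t] that assms(2) by (simp add: dvd_mod_iff)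
  have "eventually_repeats (directed_cycle n) ?c T"
    unfolding eventually_repeats_def
  proof (intro exI allI ballI impI)
    fix t v assume "v \<in> pverts (directed_cycle n)"
    then have "v < n" by (simp add: directed_cycle_def)
    then show "pcf_game (directed_cycle n) ?c t v = pcf_game (directed_cycle n) ?c (t + T) v"
      by (simp add: g flip: add.assoc)
  qed
  moreover have "T \<le> S" if "S > 0" and rep: "eventually_repeats (directed_cycle n) ?c S" for S
  proof -
    obtain t0 where t0: "\<And>t v. t \<ge> t0 \<Longrightarrow> v < n \<Longrightarrow>
        pcf_game (directed_cycle n) ?c t v = pcf_game (directed_cycle n) ?c (t + S) v"
      using rep unfolding eventually_repeats_def by (auto simp: directed_cycle_def)
    \<comment> \<open>Round \<open>t0 * T\<close> is late enough and, being a multiple of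
      \<open>T\<close>, has a chip on vertex 0; that chip must be there again \<open>S\<close>
      rounds later.\<close>
    have "t0 \<le> t0 * T" using \<open>T > 0\<close> by simp
    from t0[OF this assms(1)] have "of_bool (T dvd S) = (1 :: nat)"
      using assms(1) by (simp add: g)
    then have "T dvd S" by (simp only: of_bool_eq_1_iff)
    with \<open>S > 0\<close> show ?thesis by (simp add: dvd_imp_le)
  qed
  ultimately show ?thesis
    using \<open>T > 0\<close> by (simp add: has_period_def)
qed

theorem theorem3p5:
  fixes n T :: nat
  assumes "n \<ge> 2" and "T > 0"
  shows "(\<exists>c. has_period (directed_cycle n) c T) \<longleftrightarrow> T dvd n"
proof
  assume "\<exists>c. has_period (directed_cycle n) c T"
  then show "T dvd n"
    using has_period_dvd directed_cycle_eventually_repeats by blast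
next
  assume "T dvd n"
  with assms(1) show "\<exists>c. has_period (directed_cycle n) c T"
    using has_period_directed_cycle_multiples[of n T] by auto
qed

end
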